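(* Let $N\ge 3$ and $N=rq$ with positive integers $r,q$, and let $R$ be a set of $r$ rim vertices of the wheel graph $W_{N+1}$ (with central vertex $c$) chosen at equal intervals, i.e. all of whose cyclic intervals satisfy $d_1=d_2=\cdots=d_r=q$. Then $$\mathcal F_{W_{N+1}}(\{c\}\cup R)=\tau\bigl(W_{N+1}/(\{c\}\cup R)\bigr)=F_{2q}^{\,r}.$$
   Context: The wheel graph $W_{N+1}$ ($N\ge3$) has vertex set $\{c,v_1,\ldots,v_N\}$ and edges $\{v_i,v_{i+1}\}$ (indices modulo $N$) and $\{c,v_i\}$ for $1\le i\le N$; $c$ is the central vertex and the $v_i$ are the rim vertices. For a set $R=\{v_{a_1},\ldots,v_{a_r}\}$ of rim vertices with $1\le a_1<\cdots<a_r\le N$, the cyclic intervals are $d_i=a_{i+1}-a_i$ for $1\le i\le r-1$ and $d_r=a_1+N-a_r$. For a finite connected graph $G$ and $\varnothing\ne S\subseteq V(G)$, a rooted spanning forest of $G$ with root set $S$ is a spanning forest (an acyclic subgraph containing all vertices of $G$) in which each connected component contains exactly one vertex of $S$; $\mathcal F_G(S)$ denotes the number of such forests. $G/S$ is the multigraph obtained from $G$ by identifying all vertices of $S$ into a single vertex, keeping multiple edges with their multiplicities and deleting loops (when $S=V(G)$ this is a single vertex). $\tau(H)$ is the number of spanning trees of $H$, where parallel edges are regarded as distinct. Fibonacci numbers: $F_0=0$, $F_1=1$, $F_{n+2}=F_{n+1}+F_n$. *)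

theory Defs
  imports Main "HOL-Number_Theory.Fib"
begin

section \<open>Undirected multigraphs\<close>

text \<open>
  Edges are labels of an arbitrary type, and \<open>ends\<close> gives the one-element (loop) or
  two-element set of end vertices of an edge. Parallel edges are distinct labels with the same
  ends. A simple graph is the case where an edge is a two-element vertex set and \<open>ends\<close> is the
  identity.
\<close>

record ('v, 'e) mgraph =
  verts :: "'v set"
  edges :: "'e set"
  ends :: "'e \<Rightarrow> 'v set"

definition spanning_subgraph :: "('v, 'e) mgraph \<Rightarrow> 'e set \<Rightarrow> ('v, 'e) mgraph" where
  "spanning_subgraph G T = G\<lparr>edges := T\<rparr>"

definition adjacent :: "('v, 'e) mgraph \<Rightarrow> ('v \<times> 'v) set" where
  "adjacent G = {(u, v). \<exists>e \<in> edges G. ends G e = {u, v}}"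

definition component_of :: "('v, 'e) mgraph \<Rightarrow> 'v \<Rightarrow> 'v set" where
  "component_of G u = {v \<in> verts G. (u, v) \<in> (adjacent G)\<^sup>*}"

definition components :: "('v, 'e) mgraph \<Rightarrow> 'v set set" where
  "components G = component_of G ` verts G"

definition connected_mgraph :: "('v, 'e) mgraph \<Rightarrow> bool" where
  "connected_mgraph G \<longleftrightarrow>
     verts G \<noteq> {} \<and> (\<forall>u \<in> verts G. \<forall>v \<in> verts G. (u, v) \<in> (adjacent G)\<^sup>*)"

text \<open>
  A cycle is given by distinct vertices \<open>vs\<close> and distinct edges \<open>es\<close>, equally many, the \<open>i\<close>-th edge
  joining the \<open>i\<close>-th vertex to the cyclically next one. Length 1 is a loop and length 2 a pair of
  distinct parallel edges.
\<close>

definition is_cycle :: "('v, 'e) mgraph \<Rightarrow> 'v list \<Rightarrow> 'e list \<Rightarrow> bool" where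
  "is_cycle G vs es \<longleftrightarrow>
     es \<noteq> [] \<and> length vs = length es \<and> distinct vs \<and> distinct es \<and>
     set vs \<subseteq> verts G \<and> set es \<subseteq> edges G \<and>
     (\<forall>i < length es. ends G (es ! i) = {vs ! i, vs ! ((i + 1) mod length es)})"

definition acyclic_mgraph :: "('v, 'e) mgraph \<Rightarrow> bool" where
  "acyclic_mgraph G \<longleftrightarrow> (\<nexists>vs es. is_cycle G vs es)"

text \<open>Spanning forests and trees are identified with their edge sets.\<close>

definition spanning_trees :: "('v, 'e) mgraph \<Rightarrow> 'e set set" where
  "spanning_trees G =
     {T. T \<subseteq> edges G \<and> connected_mgraph (spanning_subgraph G T) \<and>
         acyclic_mgraph (spanning_subgraph G T)}"

definition tau :: "('v, 'e) mgraph \<Rightarrow> nat" where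
  "tau G = card (spanning_trees G)"

definition rooted_spanning_forests :: "('v, 'e) mgraph \<Rightarrow> 'v set \<Rightarrow> 'e set set" where
  "rooted_spanning_forests G S =
     {T. T \<subseteq> edges G \<and> acyclic_mgraph (spanning_subgraph G T) \<and>
         (\<forall>C \<in> components (spanning_subgraph G T). \<exists>!s. s \<in> S \<and> s \<in> C)}"

definition num_rooted_forests :: "('v, 'e) mgraph \<Rightarrow> 'v set \<Rightarrow> nat" where
  "num_rooted_forests G S = card (rooted_spanning_forests G S)"

text \<open>
  In \<open>G/S\<close> the merged vertex is \<open>S\<close> itself and every other vertex \<open>v\<close> becomes \<open>{v}\<close>. Edges keep
  their labels, hence their multiplicities.
\<close>

definition merge :: "'v set \<Rightarrow> 'v \<Rightarrow> 'v set" where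
  "merge S v = (if v \<in> S then S else {v})"

definition contract :: "('v, 'e) mgraph \<Rightarrow> 'v set \<Rightarrow> ('v set, 'e) mgraph" where
  "contract G S =
     \<lparr>verts = merge S ` verts G,
      edges = {e \<in> edges G. \<nexists>x. merge S ` ends G e = {x}},
      ends = (\<lambda>e. merge S ` ends G e)\<rparr>"


section \<open>Wheel graphs\<close>

datatype wheel_vertex = Center | Rim nat

definition rim_vertices :: "nat \<Rightarrow> wheel_vertex set" where
  "rim_vertices N = Rim ` {1..N}"

text \<open>
  \<open>wheel N\<close> is the wheel with \<open>N\<close> rim vertices, i.e. \<open>W\<^bsub>N+1\<^esub>\<close>; the successor of \<open>i \<in> {1..N}\<close> in
  cyclic order is \<open>i mod N + 1\<close>.
\<close>

definition wheel :: "nat \<Rightarrow> (wheel_vertex, wheel_vertex set) mgraph" where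
  "wheel N =
     \<lparr>verts = insert Center (rim_vertices N),
      edges = (\<lambda>i. {Rim i, Rim (i mod N + 1)}) ` {1..N} \<union> (\<lambda>i. {Center, Rim i}) ` {1..N},
      ends = (\<lambda>e. e)\<rparr>"

text \<open>
  Lists are indexed from 0, so \<open>a\<^sub>i\<close> is \<open>a ! (i - 1)\<close>. The truncated subtractions are exact for
  nonempty \<open>R \<subseteq> rim_vertices N\<close> and \<open>1 \<le> i \<le> card R\<close>.
\<close>

definition cyclic_interval :: "nat \<Rightarrow> wheel_vertex set \<Rightarrow> nat \<Rightarrow> nat" where
  "cyclic_interval N R i =
     (let a = sorted_list_of_set {j. Rim j \<in> R}; r = length a
      in if i < r then a ! i - a ! (i - 1) else a ! 0 + N - a ! (r - 1))"

end

theory Submission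
  imports Defs "HOL-Number_Theory.Cong"
begin

text \<open>
  A spanning forest rooted at \<open>S\<close> is the same as a choice, for every vertex outside \<open>S\<close>, of a parent
  edge such that following parents never cycles. Such choices are insensitive to identifying the
  vertices of \<open>S\<close>, so the forests rooted at \<open>S\<close> and the spanning trees of \<open>G/S\<close> are the same edge
  sets. In the wheel with \<open>c\<close> among the roots, every other rim vertex chooses the hub, its successor
  or its predecessor; since some rim vertex is a root, the only possible cycles are those in which
  two neighbours choose each other. Words over these three letters avoiding this pattern
  are counted by a linear recursion whose solution on a block of \<open>q - 1\<close> non-roots is \<open>F\<^sub>2\<^sub>q\<close>.
\<close>

section \<open>Rooted forests as parent maps\<close>

text \<open>The record leaves \<open>ends\<close> unconstrained, so it must be required separately
  that the ends of edges are vertices.\<close>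

definition wf_mgraph :: "('v, 'e) mgraph \<Rightarrow> bool" where
  "wf_mgraph G \<longleftrightarrow> (\<forall>e \<in> edges G. \<exists>u \<in> verts G. \<exists>v \<in> verts G. ends G e = {u, v})"

text \<open>\<open>p\<close> gives the parent edge, \<open>f\<close> the parent, and the rank \<open>h\<close> certifies acyclicity.\<close>

definition parent_map ::
  "('v, 'e) mgraph \<Rightarrow> 'v set \<Rightarrow> ('v \<Rightarrow> 'e) \<Rightarrow> ('v \<Rightarrow> 'v) \<Rightarrow> ('v \<Rightarrow> nat) \<Rightarrow> bool" where
  "parent_map G S p f h \<longleftrightarrow>
     (\<forall>v \<in> verts G - S. p v \<in> edges G \<and> ends G (p v) = {v, f v} \<and> f v \<in> verts G \<and> h (f v) < h v)"

section \<open>Walks and cycles in spanning subgraphs\<close>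

lemma spanning_subgraph_simps [simp]:
  "verts (spanning_subgraph G T) = verts G"
  "edges (spanning_subgraph G T) = T"
  "ends (spanning_subgraph G T) = ends G"
  by (simp_all add: spanning_subgraph_def)

lemma adjacent_sym: "(u, v) \<in> adjacent G \<Longrightarrow> (v, u) \<in> adjacent G"
  by (auto simp: adjacent_def insert_commute)

lemma adjacent_rtrancl_sym: "(u, v) \<in> (adjacent G)\<^sup>* \<Longrightarrow> (v, u) \<in> (adjacent G)\<^sup>*"
  by (meson adjacent_sym symI sym_rtrancl symD)

text \<open>A walk of minimal length repeats no vertex, since cutting out the stretch between two
  visits would shorten it.\<close>

lemma rtrancl_distinct_path:
  assumes "(a, b) \<in> r\<^sup>*"
  obtains f n where "f 0 = a" "f n = b" "\<forall>i<n. (f i, f (Suc i)) \<in> r" "inj_on f {..n}"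
proof -
  let ?P = "\<lambda>n. (a, b) \<in> r ^^ n"
  define n where "n = (LEAST n. ?P n)"
  have "\<exists>n. ?P n" using assms by (simp add: rtrancl_power)
  then have "?P n" unfolding n_def by (metis LeastI)
  then obtain f where f: "f 0 = a" "f n = b" "\<forall>i<n. (f i, f (Suc i)) \<in> r"
    by (auto simp: relpow_fun_conv)
  have "f i \<noteq> f j" if "i < j" "j \<le> n" for i j
  proof
    assume eq: "f i = f j"
    have "(a, f i) \<in> r ^^ i"
      using f that by (auto simp: relpow_fun_conv intro!: exI[of _ f])
    moreover have "(f j, b) \<in> r ^^ (n - j)"
      using f that by (auto simp: relpow_fun_conv intro!: exI[of _ "\<lambda>k. f (j + k)"])
    ultimately have "?P (i + (n - j))"
      using eq by (auto simp: relpow_add)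
    then have "n \<le> i + (n - j)" unfolding n_def by (rule Least_le)
    then show False using that by simp
  qed
  then have "inj_on f {..n}"
    by (metis atMost_iff inj_onI linorder_neqE_nat)
  then show thesis using that f by blast
qed

text \<open>A simple path from \<open>u\<close> to \<open>v\<close> that avoids \<open>e\<close>
  closes up with \<open>e\<close> to a cycle; when \<open>u = v\<close> the path is trivial and
  \<open>e\<close> is a loop.\<close>

lemma acyclic_no_bypass:
  assumes wf: "wf_mgraph G" and ac: "acyclic_mgraph (spanning_subgraph G T)"
    and T: "T \<subseteq> edges G" and e: "e \<in> T" "ends G e = {u, v}"
  shows "(u, v) \<notin> (adjacent (spanning_subgraph G (T - {e})))\<^sup>*"
proof
  assume "(u, v) \<in> (adjacent (spanning_subgraph G (T - {e})))\<^sup>*"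
  then obtain f n where f: "f 0 = u" "f n = v" "inj_on f {..n}"
    "\<forall>i<n. (f i, f (Suc i)) \<in> adjacent (spanning_subgraph G (T - {e}))"
    by (metis rtrancl_distinct_path)
  then have "\<forall>i<n. \<exists>d. d \<in> T - {e} \<and> ends G d = {f i, f (Suc i)}"
    by (auto simp: adjacent_def)
  then obtain g where g: "\<forall>i<n. g i \<in> T - {e} \<and> ends G (g i) = {f i, f (Suc i)}"
    by metis
  have ends_in: "ends G d \<subseteq> verts G" if "d \<in> T" for d
    using wf T that by (force simp: wf_mgraph_def)
  have inj: "inj_on g {..<n}"
  proof (rule linorder_inj_onI')
    fix i j assume ij: "i \<in> {..<n}" "j \<in> {..<n}" "i < j"
    \<comment> \<open>The vertex \<open>f i\<close> is an end of \<open>g i\<close> but of no later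
      edge of the path.\<close>
    have "f i \<noteq> f j" "f i \<noteq> f (Suc j)"
      using ij inj_onD[OF f(3), of i j] inj_onD[OF f(3), of i "Suc j"] by auto
    then show "g i \<noteq> g j"
      using g ij by (metis insertI1 insertE lessThan_iff singletonD)
  qed
  let ?vs = "map f [0..<Suc n]" and ?es = "map g [0..<n] @ [e]"
  have "is_cycle (spanning_subgraph G T) ?vs ?es"
    unfolding is_cycle_def spanning_subgraph_simps
  proof (intro conjI allI impI)
    show "distinct ?vs"
      using f(3) by (simp only: distinct_map distinct_upt) (auto simp: inj_on_def)
    show "distinct ?es"
      using inj g by (auto simp: distinct_map atLeast0LessThan)
    have "f i \<in> verts G" if "i \<le> n" for i
    proof (cases "i = n")
      case True
      then show ?thesis using ends_in[of e] e f(2) by simp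
    next
      case False
      then have "g i \<in> T" "ends G (g i) = {f i, f (Suc i)}" using g that by auto
      then show ?thesis using ends_in[of "g i"] by simp
    qed
    then show "set ?vs \<subseteq> verts G" by auto
    show "set ?es \<subseteq> T" using g e by auto
    show "ends G (?es ! i) = {?vs ! i, ?vs ! ((i + 1) mod length ?es)}"
      if "i < length ?es" for i
    proof (cases "i = n")
      case True
      then show ?thesis using e f by (auto simp: nth_append simp del: upt_Suc)
    next
      case False
      then show ?thesis using that g by (auto simp: nth_append simp del: upt_Suc)
    qed
  qed auto
  then show False using ac by (auto simp: acyclic_mgraph_def)
qed

text \<open>At a vertex of largest rank on a cycle, both cycle edges would have to be its own parent
  edge. They coincide only if the cycle is a loop, which the strict drop of rank excludes.\<close>

lemma parent_map_acyclic:
  assumes pm: "parent_map G S p f h"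
  shows "acyclic_mgraph (spanning_subgraph G (p ` (verts G - S)))"
  unfolding acyclic_mgraph_def
proof
  assume "\<exists>vs es. is_cycle (spanning_subgraph G (p ` (verts G - S))) vs es"
  then obtain vs es where c: "is_cycle (spanning_subgraph G (p ` (verts G - S))) vs es"
    by blast
  define n where "n = length es"
  have n: "n > 0" "length vs = n" "distinct es" "set es \<subseteq> p ` (verts G - S)"
    and es: "\<And>i. i < n \<Longrightarrow> ends G (es ! i) = {vs ! i, vs ! ((i + 1) mod n)}"
    using c by (auto simp: is_cycle_def n_def)
  have "vs \<noteq> []" using n by auto
  then have "Max (h ` set vs) \<in> h ` set vs" by (intro Max_in) auto
  then obtain i where i: "i < n" "h (vs ! i) = Max (h ` set vs)"
    using n by (auto simp: in_set_conv_nth)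
  have top: "h (vs ! j) \<le> h (vs ! i)" if "j < n" for j
    using that n i by auto
  \<comment> \<open>Of the two ends of a parent edge, its owner has the larger rank, so here the
    owner is the vertex of maximal rank.\<close>
  have up: "e = p (vs ! i) \<and> vs ! i \<in> verts G - S"
    if e: "e \<in> set es" "ends G e = {vs ! i, vs ! j}" "j < n" for e j
  proof -
    obtain x where x: "x \<in> verts G - S" "e = p x" using e(1) n(4) by blast
    then have "{vs ! i, vs ! j} = {x, f x}" "h (f x) < h x"
      using pm e(2) by (auto simp: parent_map_def)
    then show ?thesis using top[OF e(3)] x by (auto simp: doubleton_eq_iff)
  qed
  \<comment> \<open>The index cyclically before \<open>i\<close>; adding \<open>n\<close> keeps the
    subtraction exact when \<open>i = 0\<close>.\<close>
  define k where "k = (i + n - 1) mod n"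
  have k: "k < n" "(k + 1) mod n = i"
  proof -
    show "k < n" using n by (simp add: k_def)
    have "(k + 1) mod n = (i + n - 1 + 1) mod n" unfolding k_def by (metis mod_add_left_eq)
    also have "\<dots> = i" using n i by simp
    finally show "(k + 1) mod n = i" .
  qed
  have "es ! i = p (vs ! i) \<and> vs ! i \<in> verts G - S"
    using i n by (intro up[OF _ es[OF i(1)]]) (auto simp: n_def)
  moreover have "es ! k = p (vs ! i)"
    using k n es[OF k(1)] up[of "es ! k" k] by (auto simp: n_def insert_commute)
  ultimately have "es ! i = es ! k" and i_in: "vs ! i \<in> verts G - S" "es ! i = p (vs ! i)" by auto
  then have "i = k" using n i k by (simp add: nth_eq_iff_index_eq n_def)
  then have "ends G (p (vs ! i)) = {vs ! i}" using es[OF i(1)] k i_in by simp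
  moreover have "ends G (p (vs ! i)) = {vs ! i, f (vs ! i)}" "h (f (vs ! i)) < h (vs ! i)"
    using pm i_in by (auto simp: parent_map_def)
  ultimately show False by (metis doubleton_eq_iff insert_absorb2 less_irrefl)
qed

text \<open>Following parents ends at a root, and every edge of the subgraph links a vertex to its
  parent, so this root stays the same along a walk. With \<open>v = u\<close> the lemma provides a
  root for \<open>u\<close>.\<close>

lemma parent_map_common_root:
  assumes pm: "parent_map G S p f h"
    and u: "u \<in> verts G" and uv: "(u, v) \<in> (adjacent (spanning_subgraph G (p ` (verts G - S))))\<^sup>*"
  shows "\<exists>s \<in> S \<inter> verts G. (u, s) \<in> {(x, f x) |x. x \<in> verts G - S}\<^sup>* \<and>
                              (v, s) \<in> {(x, f x) |x. x \<in> verts G - S}\<^sup>*"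
    (is "\<exists>s \<in> _. _ \<in> ?P\<^sup>* \<and> _")
  using uv
proof (induction rule: rtrancl_induct)
  case base
  show ?case using u
  proof (induction "h u" arbitrary: u rule: less_induct)
    case less
    show ?case
    proof (cases "u \<in> S")
      case False
      then have "h (f u) < h u" "f u \<in> verts G" "(u, f u) \<in> ?P"
        using pm less.prems by (auto simp: parent_map_def)
      then show ?thesis using less.hyps[of "f u"] by (meson converse_rtrancl_into_rtrancl)
    qed (use less.prems in blast)
  qed
next
  case (step v w)
  then obtain s where s: "s \<in> S \<inter> verts G" "(u, s) \<in> ?P\<^sup>*" "(v, s) \<in> ?P\<^sup>*" by blast
  from step(2) obtain x where x: "x \<in> verts G - S" "ends G (p x) = {v, w}"
    by (auto simp: adjacent_def)
  then have "{x, f x} = {v, w}" using pm by (auto simp: parent_map_def)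
  then consider "v = x" "w = f x" | "v = f x" "w = x" by (auto simp: doubleton_eq_iff)
  then have "(w, s) \<in> ?P\<^sup>*"
  proof cases
    case 1
    \<comment> \<open>Here \<open>v\<close> is no root, so its parent chain to \<open>s\<close> is
      nonempty and starts with the step to \<open>w\<close>.\<close>
    then show ?thesis using s x by (auto elim: converse_rtranclE)
  next
    case 2
    then have "(w, v) \<in> ?P" using x by auto
    then show ?thesis using s by (meson converse_rtrancl_into_rtrancl)
  qed
  then show ?case using s by blast
qed

text \<open>Roots have no outgoing parent step. Hence two roots in one component, whose parent
  chains would have to meet, coincide.\<close>

lemma parent_map_forest:
  assumes pm: "parent_map G S p f h" and S: "S \<subseteq> verts G"
  shows "p ` (verts G - S) \<in> rooted_spanning_forests G S"
proof -
  let ?H = "spanning_subgraph G (p ` (verts G - S))"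
  let ?P = "{(x, f x) |x. x \<in> verts G - S}"
  have "?P \<subseteq> adjacent ?H" using pm by (auto simp: adjacent_def parent_map_def)
  then have mono: "?P\<^sup>* \<subseteq> (adjacent ?H)\<^sup>*" by (rule rtrancl_mono)
  have fixed: "x = s" if "(s, x) \<in> ?P\<^sup>*" "s \<in> S" for s x
    using that by (auto elim: converse_rtranclE)
  have "\<exists>!s. s \<in> S \<and> s \<in> component_of ?H u" if u: "u \<in> verts G" for u
  proof -
    obtain s where s: "s \<in> S" "(u, s) \<in> ?P\<^sup>*"
      using parent_map_common_root[OF pm u, of u] by blast
    show ?thesis
    proof
      show "s \<in> S \<and> s \<in> component_of ?H u"
        using s S mono by (auto simp: component_of_def)
    next
      fix t assume t: "t \<in> S \<and> t \<in> component_of ?H u"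
      then have "(s, t) \<in> (adjacent ?H)\<^sup>*"
        using s mono by (auto simp: component_of_def dest: adjacent_rtrancl_sym intro: rtrancl_trans)
      then obtain x where "(s, x) \<in> ?P\<^sup>*" "(t, x) \<in> ?P\<^sup>*"
        using parent_map_common_root[OF pm, of s t] s S by blast
      then show "t = s" using fixed[of s x] fixed[of t x] s t by blast
    qed
  qed
  then show ?thesis
    using parent_map_acyclic[OF pm] pm
    by (auto simp: rooted_spanning_forests_def components_def parent_map_def)
qed

text \<open>The parent is the next vertex on a shortest walk to a root, and the rank is the distance
  to the nearest root.\<close>

lemma forest_parent_map:
  assumes wf: "wf_mgraph G" and T: "T \<in> rooted_spanning_forests G S"
  obtains p f h where "parent_map G S p f h" "T = p ` (verts G - S)"
proof -
  let ?A = "adjacent (spanning_subgraph G T)"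
  have TE: "T \<subseteq> edges G" and ac: "acyclic_mgraph (spanning_subgraph G T)"
    and root: "\<And>u. u \<in> verts G \<Longrightarrow> \<exists>!s. s \<in> S \<and> s \<in> component_of (spanning_subgraph G T) u"
    using T by (auto simp: rooted_spanning_forests_def components_def)
  define h where "h v = (LEAST n. \<exists>s \<in> S \<inter> verts G. (v, s) \<in> ?A ^^ n)" for v
  have "\<exists>e w. e \<in> T \<and> ends G e = {v, w} \<and> w \<in> verts G \<and> h w < h v" if v: "v \<in> verts G - S" for v
  proof -
    have "\<exists>n. \<exists>s \<in> S \<inter> verts G. (v, s) \<in> ?A ^^ n"
      using root[of v] v by (auto simp: component_of_def rtrancl_power)
    then have "\<exists>s \<in> S \<inter> verts G. (v, s) \<in> ?A ^^ h v"
      unfolding h_def by (rule LeastI_ex)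
    then obtain s where s: "s \<in> S \<inter> verts G" "(v, s) \<in> ?A ^^ h v" by blast
    with v obtain n where n: "h v = Suc n" by (cases "h v") auto
    with s obtain w where w: "(v, w) \<in> ?A" "(w, s) \<in> ?A ^^ n"
      by (metis relpow_Suc_D2)
    then have "h w \<le> n" unfolding h_def using s by (intro Least_le) blast
    moreover obtain e where e: "e \<in> T" "ends G e = {v, w}" using w by (auto simp: adjacent_def)
    moreover have "w \<in> verts G" using wf TE e by (force simp: wf_mgraph_def)
    ultimately show ?thesis using n by (metis le_imp_less_Suc)
  qed
  then obtain p f where pf: "\<And>v. v \<in> verts G - S \<Longrightarrow>
      p v \<in> T \<and> ends G (p v) = {v, f v} \<and> f v \<in> verts G \<and> h (f v) < h v"
    by metis
  then have pm: "parent_map G S p f h" using TE by (auto simp: parent_map_def)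
  let ?T' = "p ` (verts G - S)"
  let ?P = "{(x, f x) |x. x \<in> verts G - S}"
  \<comment> \<open>Parent edges would join both ends of an edge outside \<open>?T'\<close> to the
    same root, which gives a bypass of that edge.\<close>
  have "e \<in> ?T'" if e: "e \<in> T" for e
  proof (rule ccontr)
    assume ne: "e \<notin> ?T'"
    obtain u v where uv: "u \<in> verts G" "v \<in> verts G" "ends G e = {u, v}"
      using subsetD[OF TE e] wf unfolding wf_mgraph_def by blast
    obtain s t where s: "s \<in> S \<inter> verts G" "(u, s) \<in> ?P\<^sup>*" and t: "t \<in> S \<inter> verts G" "(v, t) \<in> ?P\<^sup>*"
      using parent_map_common_root[OF pm uv(1), of u] parent_map_common_root[OF pm uv(2), of v]
      by blast
    have "?P \<subseteq> adjacent (spanning_subgraph G (T - {e}))"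
      using pf ne by (auto simp: adjacent_def)
    then have P1: "?P\<^sup>* \<subseteq> (adjacent (spanning_subgraph G (T - {e})))\<^sup>*" by (rule rtrancl_mono)
    have "?P \<subseteq> ?A" using pf by (auto simp: adjacent_def)
    then have P2: "?P\<^sup>* \<subseteq> ?A\<^sup>*" by (rule rtrancl_mono)
    have "(u, v) \<in> ?A" using uv e by (auto simp: adjacent_def)
    then have "(u, t) \<in> ?A\<^sup>*" using t P2 by (auto intro: converse_rtrancl_into_rtrancl)
    \<comment> \<open>Both lie in the component of \<open>u\<close>, which contains only one
      root.\<close>
    then have "s = t" using root[OF uv(1)] s t P2 by (auto simp: component_of_def)
    then have "(u, v) \<in> (adjacent (spanning_subgraph G (T - {e})))\<^sup>*"
      using s t P1 by (meson adjacent_rtrancl_sym rtrancl_trans subsetD)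
    then show False using acyclic_no_bypass[OF wf ac TE e uv(3)] by blast
  qed
  then have "T = ?T'" using pf by auto
  then show thesis using that pm by blast
qed

lemma rooted_spanning_forests_eq:
  assumes "wf_mgraph G" "S \<subseteq> verts G"
  shows "rooted_spanning_forests G S = {p ` (verts G - S) |p f h. parent_map G S p f h}"
proof (intro equalityI subsetI)
  fix T assume "T \<in> rooted_spanning_forests G S"
  then obtain p f h where "parent_map G S p f h" "T = p ` (verts G - S)"
    by (rule forest_parent_map[OF assms(1)])
  then show "T \<in> {p ` (verts G - S) |p f h. parent_map G S p f h}" by blast
next
  fix T assume "T \<in> {p ` (verts G - S) |p f h. parent_map G S p f h}"
  then show "T \<in> rooted_spanning_forests G S" using parent_map_forest[OF _ assms(2)] by blast
qed

text \<open>If the two maps differ at \<open>v\<close>, they also differ at the parent of \<open>v\<close> under either of them.\<close>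

lemma parent_map_unique:
  assumes pm: "parent_map G S p f h" and pm': "parent_map G S p' f' h'"
    and img: "p ` (verts G - S) = p' ` (verts G - S)" and v: "v \<in> verts G - S"
  shows "p v = p' v"
  using v
proof (induction "h' v" arbitrary: v rule: less_induct)
  case less
  show ?case
  proof (rule ccontr)
    assume ne: "p v \<noteq> p' v"
    obtain u where u: "u \<in> verts G - S" "p' v = p u" using img less.prems by (metis imageE imageI)
    have "{u, f u} = {v, f' v}" and h': "h' (f' v) < h' v"
      using pm pm' u less.prems unfolding parent_map_def by metis+
    moreover have "u \<noteq> v" using ne u by auto
    ultimately have uf: "u = f' v" by (auto simp: doubleton_eq_iff)
    then have "p' u = p' v" using less.hyps[of u] u h' by metis
    then have "{u, f' u} = {v, f' v}" "h' (f' u) < h' u"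
      using pm' u less.prems unfolding parent_map_def by metis+
    then show False using uf \<open>u \<noteq> v\<close> h' by (auto simp: doubleton_eq_iff)
  qed
qed

section \<open>Contraction of the root set\<close>

text \<open>With a single root, demanding it in every component amounts to having only one
  component.\<close>

lemma spanning_trees_eq_rooted_forests:
  assumes "s \<in> verts G"
  shows "spanning_trees G = rooted_spanning_forests G {s}"
proof -
  have "connected_mgraph (spanning_subgraph G T) \<longleftrightarrow>
      (\<forall>C \<in> components (spanning_subgraph G T). \<exists>!x. x \<in> {s} \<and> x \<in> C)" for T
    using assms unfolding connected_mgraph_def components_def component_of_def
    by simp (metis adjacent_rtrancl_sym empty_iff rtrancl_trans)
  then show ?thesis by (auto simp: spanning_trees_def rooted_spanning_forests_def)
qed

lemma merge_eq_singleton_iff: "v \<notin> S \<Longrightarrow> merge S x = {v} \<longleftrightarrow> x = v"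
  by (auto simp: merge_def)

lemma wf_contract:
  assumes "wf_mgraph G"
  shows "wf_mgraph (contract G S)"
  using assms by (fastforce simp: wf_mgraph_def contract_def)

lemma verts_contract_minus:
  "verts (contract G S) - {S} = (\<lambda>v. {v}) ` (verts G - S)"
  by (auto simp: contract_def merge_def)

text \<open>\<open>the_elem\<close> recovers a nonroot from its singleton. Ranks are shifted by one
  to leave 0 for the merged vertex, and the strict drop of rank keeps parent edges from becoming
  loops.\<close>

lemma parent_map_contract:
  assumes pm: "parent_map G S p f h"
  shows "parent_map (contract G S) {S} (p \<circ> the_elem) (merge S \<circ> f \<circ> the_elem)
    (\<lambda>C. if C = S then 0 else Suc (h (the_elem C)))"
  unfolding parent_map_def verts_contract_minus
proof
  fix C assume "C \<in> (\<lambda>v. {v}) ` (verts G - S)"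
  then obtain v where v: "C = {v}" "v \<in> verts G - S" by blast
  then have pv: "p v \<in> edges G" "ends G (p v) = {v, f v}" "f v \<in> verts G" "h (f v) < h v"
    using pm by (auto simp: parent_map_def)
  have m: "merge S v = {v}" using v by (simp add: merge_def)
  have "merge S (f v) \<noteq> {v}"
    using v pv merge_eq_singleton_iff[of v S "f v"] by auto
  then have "p v \<in> edges (contract G S)" using m pv by (auto simp: contract_def)
  moreover have "merge S (f v) \<noteq> S \<longrightarrow> h (the_elem (merge S (f v))) < h v"
    using pv by (auto simp: merge_def)
  moreover have "S \<noteq> {v}" using v by blast
  ultimately show "(p \<circ> the_elem) C \<in> edges (contract G S) \<and>
      ends (contract G S) ((p \<circ> the_elem) C) = {C, (merge S \<circ> f \<circ> the_elem) C} \<and>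
      (merge S \<circ> f \<circ> the_elem) C \<in> verts (contract G S) \<and>
      (if (merge S \<circ> f \<circ> the_elem) C = S then 0
       else Suc (h (the_elem ((merge S \<circ> f \<circ> the_elem) C)))) <
      (if C = S then 0 else Suc (h (the_elem C)))"
    using v pv m \<open>S \<noteq> {v}\<close> by (simp add: contract_def)
qed

text \<open>Only members of \<open>S\<close> are identified, so an edge incident with
  \<open>{v}\<close> in the quotient is incident with \<open>v\<close> in \<open>G\<close>; the rank
  is pulled back along \<open>merge S\<close>.\<close>

lemma parent_map_of_contract:
  assumes wf: "wf_mgraph G" and pm: "parent_map (contract G S) {S} p f h"
  shows "\<exists>g. parent_map G S (\<lambda>v. p {v}) g (\<lambda>v. h (merge S v))"
proof -
  have "\<exists>w. p {v} \<in> edges G \<and> ends G (p {v}) = {v, w} \<and> w \<in> verts G \<and> h (merge S w) < h (merge S v)"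
    if v: "v \<in> verts G - S" for v
  proof -
    have "{v} \<in> verts (contract G S) - {S}" using v by (auto simp: verts_contract_minus)
    then have e: "p {v} \<in> edges G" "merge S ` ends G (p {v}) = {{v}, f {v}}" "h (f {v}) < h {v}"
      using pm by (auto simp: parent_map_def contract_def)
    obtain a b where ab: "a \<in> verts G" "b \<in> verts G" "ends G (p {v}) = {a, b}"
      using wf e by (auto simp: wf_mgraph_def)
    have "{merge S a, merge S b} = {{v}, f {v}}" using e ab by simp
    then consider "a = v" "merge S b = f {v}" | "b = v" "merge S a = f {v}"
      using v by (auto simp: doubleton_eq_iff merge_eq_singleton_iff)
    moreover have "merge S v = {v}" using v by (simp add: merge_def)
    ultimately show ?thesis using e ab by cases (auto simp: insert_commute)
  qed
  then obtain g where "\<And>v. v \<in> verts G - S \<Longrightarrow> p {v} \<in> edges G \<and> ends G (p {v}) = {v, g v}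
      \<and> g v \<in> verts G \<and> h (merge S (g v)) < h (merge S v)"
    by metis
  then show ?thesis by (auto simp: parent_map_def)
qed

lemma spanning_trees_contract:
  assumes wf: "wf_mgraph G" and S: "S \<subseteq> verts G" "S \<noteq> {}"
  shows "spanning_trees (contract G S) = rooted_spanning_forests G S"
proof -
  have S': "S \<in> verts (contract G S)" using S by (auto simp: contract_def merge_def image_iff)
  have "spanning_trees (contract G S) =
      {p ` (verts (contract G S) - {S}) |p f h. parent_map (contract G S) {S} p f h}"
    using S' by (simp add: spanning_trees_eq_rooted_forests rooted_spanning_forests_eq wf_contract wf)
  also have "\<dots> = {p ` (verts G - S) |p f h. parent_map G S p f h}"
    unfolding verts_contract_minus image_image
  proof (safe, goal_cases)
    case (1 _ p f h)
    then show ?case using parent_map_of_contract[OF wf] by (metis (mono_tags))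
  next
    case (2 _ p f h)
    then show ?case using parent_map_contract[OF 2] by (intro exI[of _ "p \<circ> the_elem"]) auto
  qed
  finally show ?thesis using rooted_spanning_forests_eq[OF wf S(1)] by simp
qed


section \<open>Counting words\<close>

datatype step = Hub | Next | Prev

text \<open>Roots and positions from \<open>n\<close> on carry the dummy letter \<open>Hub\<close>.\<close>

definition words :: "nat \<Rightarrow> nat \<Rightarrow> (nat \<Rightarrow> step) set" where
  "words q n = {w. (\<forall>j. q dvd j \<or> n \<le> j \<longrightarrow> w j = Hub) \<and> (\<forall>j. w j = Next \<longrightarrow> w (Suc j) \<noteq> Prev)}"

text \<open>At a nonroot position \<open>n\<close>, these are the words that can be continued by
  \<open>Prev\<close>.\<close>

definition words_no_next :: "nat \<Rightarrow> nat \<Rightarrow> (nat \<Rightarrow> step) set" where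
  "words_no_next q n = {w \<in> words q n. w (n - 1) \<noteq> Next}"

lemma words_0: "words q 0 = {\<lambda>_. Hub}"
  by (auto simp: words_def)

lemma words_Hub: "w \<in> words q n \<Longrightarrow> n \<le> j \<Longrightarrow> w j = Hub"
  by (auto simp: words_def)

text \<open>A root carries the dummy letter, which every member of \<open>words q n\<close> already
  has at position \<open>n\<close>.\<close>

lemma words_Suc_root:
  assumes "q dvd n"
  shows "words q (Suc n) = words q n" "words_no_next q (Suc n) = words q n"
proof -
  have "q dvd j \<or> Suc n \<le> j \<longleftrightarrow> q dvd j \<or> n \<le> j" for j
    using assms by (metis Suc_leD Suc_leI le_neq_implies_less)
  then show "words q (Suc n) = words q n" by (simp add: words_def)
  then show "words_no_next q (Suc n) = words q n"
    by (auto simp: words_no_next_def dest: words_Hub)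
qed

lemma words_Suc_iff:
  assumes "\<not> q dvd n"
  shows "w \<in> words q (Suc n) \<longleftrightarrow>
    w(n := Hub) \<in> words q n \<and> (w n = Prev \<longrightarrow> w(n := Hub) \<in> words_no_next q n)"
proof -
  obtain m where m: "n = Suc m" using assms by (cases n) auto
  show ?thesis
  proof
    assume "w \<in> words q (Suc n)"
    then have w: "\<And>j. q dvd j \<or> Suc n \<le> j \<Longrightarrow> w j = Hub" "\<And>j. w j = Next \<Longrightarrow> w (Suc j) \<noteq> Prev"
      by (auto simp: words_def)
    then show "w(n := Hub) \<in> words q n \<and> (w n = Prev \<longrightarrow> w(n := Hub) \<in> words_no_next q n)"
      using m by (auto simp: words_def words_no_next_def)
  next
    assume "w(n := Hub) \<in> words q n \<and> (w n = Prev \<longrightarrow> w(n := Hub) \<in> words_no_next q n)"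
    then have w: "\<And>j. q dvd j \<or> n \<le> j \<Longrightarrow> (w(n := Hub)) j = Hub"
        "\<And>j. (w(n := Hub)) j = Next \<Longrightarrow> (w(n := Hub)) (Suc j) \<noteq> Prev"
      and p: "w n = Prev \<Longrightarrow> w m \<noteq> Next"
      using m by (auto simp: words_def words_no_next_def)
    have "w j = Hub" if "q dvd j \<or> Suc n \<le> j" for j
      using w(1)[of j] that assms by (auto split: if_splits)
    moreover have "w (Suc j) \<noteq> Prev" if "w j = Next" for j
    proof -
      \<comment> \<open>Position \<open>n\<close> is followed by the dummy letter, the pair at
        \<open>m\<close> and \<open>n\<close> is the new one, and all other pairs are
        inherited.\<close>
      consider "j = n" | "j = m" | "j \<noteq> n" "Suc j \<noteq> n" using m by blast
      then show ?thesis
        using w(2)[of j] w(1)[of "Suc j"] p that m by cases auto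
    qed
    ultimately show "w \<in> words q (Suc n)" by (auto simp: words_def)
  qed
qed

section \<open>Recursion for the number of words\<close>

lemma upd_image_iff:
  assumes "\<forall>w \<in> W. w n = a"
  shows "w \<in> (\<lambda>w. w(n := c)) ` W \<longleftrightarrow> w n = c \<and> w(n := a) \<in> W"
proof
  assume "w \<in> (\<lambda>w. w(n := c)) ` W"
  then show "w n = c \<and> w(n := a) \<in> W" using assms by (auto simp: fun_upd_idem)
next
  assume w: "w n = c \<and> w(n := a) \<in> W"
  then have "w = (w(n := a))(n := c)" by auto
  then show "w \<in> (\<lambda>w. w(n := c)) ` W" using w by blast
qed

lemma inj_on_upd:
  assumes "\<And>w. w \<in> W \<Longrightarrow> w n = a"
  shows "inj_on (\<lambda>w. w(n := c)) W"
  by (rule inj_onI) (metis assms fun_upd_triv fun_upd_upd)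

text \<open>Appending \<open>Hub\<close> changes nothing, as it is the default from \<open>n\<close>
  on, so the first set needs no update. Only \<open>Prev\<close> depends on the letter before
  it.\<close>

lemma words_Suc:
  assumes "\<not> q dvd n"
  shows "words q (Suc n) = words q n \<union> (\<lambda>w. w(n := Prev)) ` words_no_next q n
           \<union> (\<lambda>w. w(n := Next)) ` words q n" (is "_ = ?A \<union> ?B \<union> ?C")
    and "words_no_next q (Suc n) = words q n \<union> (\<lambda>w. w(n := Prev)) ` words_no_next q n"
proof -
  have hub: "w n = Hub" if "w \<in> words q n" for w using that words_Hub by blast
  then have hub': "w n = Hub" if "w \<in> words_no_next q n" for w using that words_no_next_def by auto
  have A: "w \<in> ?A \<longleftrightarrow> w n = Hub \<and> w(n := Hub) \<in> words q n" for w
    using hub by (metis fun_upd_triv)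
  have sub: "words_no_next q n \<subseteq> words q n" by (auto simp: words_no_next_def)
  have "w \<in> words q (Suc n) \<longleftrightarrow> w \<in> ?A \<union> ?B \<union> ?C" for w
    using A[of w] upd_image_iff[of "words q n" n Hub w Next] hub
      upd_image_iff[of "words_no_next q n" n Hub w Prev] hub' sub
    unfolding words_Suc_iff[OF assms] by (cases "w n") auto
  then show *: "words q (Suc n) = ?A \<union> ?B \<union> ?C" by blast
  have "w n \<noteq> Next" if "w \<in> ?A \<union> ?B" for w using that hub[of w] by auto
  moreover have "w n = Next" if "w \<in> ?C" for w using that by auto
  ultimately show "words_no_next q (Suc n) = ?A \<union> ?B"
    unfolding words_no_next_def[of _ "Suc n"] * by auto
qed

lemma finite_words: "finite (words q n)"
proof (induction n)
  case (Suc n)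
  then have "finite (words_no_next q n)" by (simp add: words_no_next_def)
  with Suc show ?case using words_Suc(1)[of q n] words_Suc_root(1)[of q n] by (cases "q dvd n") auto
qed (simp add: words_0)

lemma card_words_Suc:
  assumes "\<not> q dvd n"
  shows "card (words q (Suc n)) = 2 * card (words q n) + card (words_no_next q n)"
    and "card (words_no_next q (Suc n)) = card (words q n) + card (words_no_next q n)"
proof -
  let ?A = "words q n" and ?B = "(\<lambda>w. w(n := Prev)) ` words_no_next q n"
    and ?C = "(\<lambda>w. w(n := Next)) ` words q n"
  have hub: "w n = Hub" if "w \<in> words q n" for w using that words_Hub by blast
  have sub: "words_no_next q n \<subseteq> words q n" by (auto simp: words_no_next_def)
  have fin: "finite ?A" "finite ?B" "finite ?C"
    using finite_words[of q n] finite_subset[OF sub] by auto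
  have B: "card ?B = card (words_no_next q n)"
    by (rule card_image, rule inj_on_upd[where a = Hub]) (use hub sub in blast)
  have C: "card ?C = card (words q n)"
    by (rule card_image, rule inj_on_upd[where a = Hub]) (use hub in blast)
  \<comment> \<open>Members of the three sets differ in the letter at position
    \<open>n\<close>.\<close>
  have "?A \<inter> ?B = {}" "(?A \<union> ?B) \<inter> ?C = {}"
    using hub by (force dest: fun_cong[of _ _ n])+
  then show "card (words_no_next q (Suc n)) = card (words q n) + card (words_no_next q n)"
    and "card (words q (Suc n)) = 2 * card (words q n) + card (words_no_next q n)"
    unfolding words_Suc[OF assms] using fin B C by (simp_all add: card_Un_disjoint)
qed

text \<open>The pair of counts evolves by (a, b) -> (2a + b, a + b), which is two steps of the
  Fibonacci recursion. The root at \<open>m * q\<close> leaves the number of words unchanged,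
  matching the initial values \<open>fib 2 = fib 1 = 1\<close>.\<close>

lemma card_words_block:
  assumes "k < q"
  shows "card (words q (m * q + Suc k)) = card (words q (m * q)) * fib (2 * Suc k) \<and>
    card (words_no_next q (m * q + Suc k)) = card (words q (m * q)) * fib (2 * k + 1)"
  using assms
proof (induction k)
  case 0
  then show ?case using words_Suc_root[of q "m * q"] by (simp add: numeral_2_eq_2)
next
  case (Suc k)
  have "\<not> q dvd Suc k" using Suc.prems by (auto dest: dvd_imp_le)
  then have "\<not> q dvd m * q + Suc k" using dvd_add_right_iff[of q "m * q" "Suc k"] by simp
  from card_words_Suc[OF this] show ?case
    using Suc by (simp add: algebra_simps)
qed

text \<open>A block of one root and \<open>q - 1\<close> nonroots multiplies the count by
  \<open>fib (2 * q)\<close>.\<close>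

lemma card_words:
  assumes "0 < q"
  shows "card (words q (m * q)) = fib (2 * q) ^ m"
proof (induction m)
  case (Suc m)
  have "Suc m * q = m * q + Suc (q - 1)" using assms by simp
  then show ?case using card_words_block[of "q - 1" q m] Suc assms
    by (metis Suc_pred' diff_less mult.commute power_Suc zero_less_one)
qed (simp add: words_0)

section \<open>Rooted forests of the wheel as words\<close>

locale spaced_wheel =
  fixes N q b :: nat
  assumes N: "3 \<le> N" and q: "q dvd N"
begin

text \<open>The offset \<open>b\<close> rotates the rim so that the roots sit at the multiples of
  \<open>q\<close>; the remainder identifies position \<open>N\<close> with position 0.\<close>

definition pos :: "nat \<Rightarrow> wheel_vertex" where
  "pos j = Rim ((b + j) mod N + 1)"

definition roots :: "wheel_vertex set" where
  "roots = insert Center (pos ` {j. j < N \<and> q dvd j})"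

definition idx :: "wheel_vertex \<Rightarrow> nat" where
  "idx = the_inv_into {..<N} pos"

fun target :: "step \<Rightarrow> nat \<Rightarrow> wheel_vertex" where
  "target Hub j = Center"
| "target Next j = pos (Suc j)"
| "target Prev j = pos (j - 1)"

definition word_edge :: "(nat \<Rightarrow> step) \<Rightarrow> nat \<Rightarrow> wheel_vertex set" where
  "word_edge w j = {pos j, target (w j) j}"

lemma pos_eq_iff: "i < N \<Longrightarrow> j < N \<Longrightarrow> pos i = pos j \<longleftrightarrow> i = j"
proof -
  assume "i < N" "j < N"
  moreover have "(b + i) mod N = (b + j) mod N \<longleftrightarrow> i mod N = j mod N"
    using cong_add_lcancel_nat[of b i j N] by (simp add: cong_def)
  ultimately show ?thesis by (simp add: pos_def)
qed

lemma pos_N: "pos N = pos 0" by (simp add: pos_def)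

lemma pos_neq_Center [simp]: "pos j \<noteq> Center" "Center \<noteq> pos j"
  by (simp_all add: pos_def)

lemma idx_pos: "j < N \<Longrightarrow> idx (pos j) = j"
  unfolding idx_def by (rule the_inv_into_f_f) (auto simp: inj_on_def pos_eq_iff)

text \<open>An injection between sets of equal finite size is onto. This re-indexes the vertices and
  edges of the wheel by positions.\<close>

lemma rotation_image: "(\<lambda>j. (b + j) mod N + 1) ` {..<N} = {1..N}"
proof (rule card_subset_eq)
  have "inj_on (\<lambda>j. (b + j) mod N + 1) {..<N}"
    using pos_eq_iff by (auto simp: inj_on_def pos_def)
  then show "card ((\<lambda>j. (b + j) mod N + 1) ` {..<N}) = card {1..N}" by (simp add: card_image)
  show "(\<lambda>j. (b + j) mod N + 1) ` {..<N} \<subseteq> {1..N}" using N by (auto simp: Suc_le_eq)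
qed simp

lemma verts_wheel: "verts (wheel N) = insert Center (pos ` {..<N})"
  unfolding wheel_def rim_vertices_def rotation_image[symmetric] by (auto simp: pos_def)

lemma edges_wheel:
  "edges (wheel N) = (\<lambda>j. {pos j, pos (Suc j)}) ` {..<N} \<union> (\<lambda>j. {Center, pos j}) ` {..<N}"
  unfolding wheel_def rotation_image[symmetric] image_image by (simp add: pos_def mod_Suc_eq)

lemma ends_wheel: "ends (wheel N) e = e"
  by (simp add: wheel_def)

lemma pos_in_verts: "pos j \<in> verts (wheel N)"
proof -
  have "pos j = pos (j mod N)" by (simp add: pos_def mod_add_right_eq)
  then show ?thesis using N by (auto simp: verts_wheel)
qed

lemma wf_wheel: "wf_mgraph (wheel N)"
proof -
  have "Center \<in> verts (wheel N)" by (simp add: verts_wheel)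
  then show ?thesis
    unfolding wf_mgraph_def edges_wheel ends_wheel using pos_in_verts by blast
qed

lemma roots_subset: "roots \<subseteq> verts (wheel N)"
  by (auto simp: roots_def verts_wheel)

lemma pos_in_roots_iff: "j < N \<Longrightarrow> pos j \<in> roots \<longleftrightarrow> q dvd j"
  by (auto simp: roots_def pos_eq_iff)

lemma pos_root: "j \<le> N \<Longrightarrow> q dvd j \<Longrightarrow> pos j \<in> roots"
  using N pos_in_roots_iff[of j] pos_in_roots_iff[of 0] by (cases "j = N") (auto simp: pos_N)

lemma nonroots: "verts (wheel N) - roots = pos ` {j. j < N \<and> \<not> q dvd j}"
  using pos_in_roots_iff by (auto simp: verts_wheel roots_def)

text \<open>The hub and the two rim neighbours are distinct because \<open>N\<close> is at least 3,
  so the parent determines the letter.\<close>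

lemma target_inj:
  assumes "j < N" "\<not> q dvd j" "target s j = target t j"
  shows "s = t"
proof -
  have j: "0 < j" using assms(2) by (cases j) auto
  have "pos (Suc j) \<noteq> pos (j - 1)"
  proof (cases "Suc j = N")
    case True
    then show ?thesis using pos_eq_iff[of 0 "j - 1"] N j by (auto simp: pos_N)
  next
    case False
    then show ?thesis using pos_eq_iff[of "Suc j" "j - 1"] assms(1) by auto
  qed
  then show ?thesis using assms(3) by (cases s; cases t) auto
qed

lemma word_edge_in_edges:
  assumes "j < N" "\<not> q dvd j"
  shows "word_edge w j \<in> edges (wheel N)"
proof -
  obtain i where i: "j = Suc i" using assms by (cases j) auto
  then have "i < N" using assms by simp
  then show ?thesis
    using assms(1) i by (cases "w j") (auto simp: word_edge_def edges_wheel insert_commute)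
qed

text \<open>Roots have rank 0 and nonroots attached to the hub have rank 1. The offsets keep all
  other nonroots above 1, as their index lies strictly between 0 and \<open>N\<close>.\<close>

definition word_rank :: "(nat \<Rightarrow> step) \<Rightarrow> wheel_vertex \<Rightarrow> nat" where
  "word_rank w v = (if v \<in> roots then 0
     else (case w (idx v) of Hub \<Rightarrow> 1 | Next \<Rightarrow> 2 + N - idx v | Prev \<Rightarrow> 1 + idx v))"

text \<open>
  The rank decreases towards the parent: a run of \<open>Next\<close> moves right and a run of \<open>Prev\<close> moves
  left, and neither crosses position \<open>0\<close>, which is a root.
\<close>

lemma word_parent_map:
  assumes w: "w \<in> words q N"
  shows "parent_map (wheel N) roots (word_edge w \<circ> idx) (\<lambda>v. target (w (idx v)) (idx v)) (word_rank w)"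
  unfolding parent_map_def nonroots
proof
  fix v assume "v \<in> pos ` {j. j < N \<and> \<not> q dvd j}"
  then obtain j where j: "v = pos j" "j < N" "\<not> q dvd j" by blast
  then have j0: "0 < j" by (cases j) auto
  have h: "word_rank w (pos i) = (case w i of Hub \<Rightarrow> 1 | Next \<Rightarrow> 2 + N - i | Prev \<Rightarrow> 1 + i)"
    if "i < N" "\<not> q dvd i" for i
    using that by (simp add: word_rank_def pos_in_roots_iff idx_pos split: step.split)
  have noPrev: "w (Suc i) \<noteq> Prev" if "w i = Next" for i
    using w that by (auto simp: words_def)
  have "target (w j) j \<in> verts (wheel N)"
    using pos_in_verts by (cases "w j") (auto simp: verts_wheel)
  moreover have "word_rank w (target (w j) j) < word_rank w (pos j)"
  proof (cases "w j")
    case Hub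
    then show ?thesis using h[OF j(2,3)] by (simp add: word_rank_def roots_def)
  next
    case Next
    show ?thesis
    proof (cases "Suc j = N \<or> q dvd Suc j")
      case True
      then have "pos (Suc j) \<in> roots" using pos_root[of "Suc j"] q j by auto
      then show ?thesis using Next h[OF j(2,3)] j by (simp add: word_rank_def)
    next
      case False
      \<comment> \<open>The successor carries \<open>Hub\<close>, of rank 1, or \<open>Next\<close>,
        of rank one less than that of \<open>j\<close>.\<close>
      then have "Suc j < N" using j by simp
      with False Next h[OF j(2,3)] h[of "Suc j"] noPrev[OF Next] j show ?thesis
        by (cases "w (Suc j)") auto
    qed
  next
    case Prev
    show ?thesis
    proof (cases "q dvd j - 1")
      case True
      then have "pos (j - 1) \<in> roots" using pos_root[of "j - 1"] j by auto
      then show ?thesis using Prev h[OF j(2,3)] by (simp add: word_rank_def)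
    next
      case False
      have "w (j - 1) \<noteq> Next" using noPrev[of "j - 1"] Prev j0 by auto
      with False Prev h[OF j(2,3)] h[of "j - 1"] j j0 show ?thesis
        by (cases "w (j - 1)") auto
    qed
  qed
  ultimately show "(word_edge w \<circ> idx) v \<in> edges (wheel N) \<and>
      ends (wheel N) ((word_edge w \<circ> idx) v) = {v, target (w (idx v)) (idx v)} \<and>
      target (w (idx v)) (idx v) \<in> verts (wheel N) \<and>
      word_rank w (target (w (idx v)) (idx v)) < word_rank w v"
    using word_edge_in_edges[OF j(2,3), of w] j(1) idx_pos[OF j(2)]
    by (simp add: ends_wheel word_edge_def)
qed

section \<open>Bijection between words and rooted forests\<close>

definition word_forest :: "(nat \<Rightarrow> step) \<Rightarrow> wheel_vertex set set" where
  "word_forest w = word_edge w ` {j. j < N \<and> \<not> q dvd j}"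

lemma word_forest_eq: "word_forest w = (word_edge w \<circ> idx) ` (verts (wheel N) - roots)"
  unfolding word_forest_def nonroots image_image by (intro image_cong) (auto simp: idx_pos)

text \<open>The edge set determines the parent edge of every nonroot, and the parent edge determines
  the letter.\<close>

lemma inj_word_forest: "inj_on word_forest (words q N)"
proof (rule inj_onI)
  fix w w' assume w: "w \<in> words q N" "w' \<in> words q N" "word_forest w = word_forest w'"
  show "w = w'"
  proof
    fix j
    show "w j = w' j"
    proof (cases "j < N \<and> \<not> q dvd j")
      case True
      then have "pos j \<in> verts (wheel N) - roots" by (auto simp: nonroots)
      then have "(word_edge w \<circ> idx) (pos j) = (word_edge w' \<circ> idx) (pos j)"
        using parent_map_unique[OF word_parent_map[OF w(1)] word_parent_map[OF w(2)]] w(3)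
        unfolding word_forest_eq by blast
      then have "target (w j) j = target (w' j) j"
        using True by (auto simp: word_edge_def idx_pos doubleton_eq_iff)
      then show ?thesis using target_inj True by blast
    next
      case False
      then show ?thesis using w by (auto simp: words_def)
    qed
  qed
qed

lemma edge_at_pos:
  assumes j: "j < N" "\<not> q dvd j" and e: "{pos j, v} \<in> edges (wheel N)" "v \<noteq> pos j"
  shows "\<exists>s. v = target s j"
proof -
  consider i where "i < N" "{pos j, v} = {pos i, pos (Suc i)}"
    | i where "i < N" "{pos j, v} = {Center, pos i}"
    using e by (auto simp: edges_wheel)
  then show ?thesis
  proof cases
    case 1
    then consider "pos j = pos i" "v = pos (Suc i)" | "pos j = pos (Suc i)" "v = pos i"
      by (auto simp: doubleton_eq_iff)
    then show ?thesis
    proof cases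
      case A: 1
      then have "v = target Next j" using pos_eq_iff[of j i] j 1 by simp
      then show ?thesis ..
    next
      case A: 2
      \<comment> \<open>The edge that wraps around ends at position 0, which is a root and hence not
        \<open>j\<close>.\<close>
      have "Suc i \<noteq> N"
      proof
        assume "Suc i = N"
        then have "pos j = pos 0" using A(1) pos_N by simp
        then have "j = 0" using pos_eq_iff[of j 0] j by simp
        then show False using j by simp
      qed
      then have "j = Suc i" using pos_eq_iff[of j "Suc i"] A(1) j 1 by simp
      then have "v = target Prev j" using A by simp
      then show ?thesis ..
    qed
  next
    case 2
    then have "v = target Hub j" by (auto simp: doubleton_eq_iff)
    then show ?thesis ..
  qed
qed

lemma word_of_parent_map:
  assumes pm: "parent_map (wheel N) roots p f h"
  shows "\<exists>w \<in> words q N. p ` (verts (wheel N) - roots) = word_forest w"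
proof -
  have pj: "p (pos j) \<in> edges (wheel N)" "p (pos j) = {pos j, f (pos j)}" "h (f (pos j)) < h (pos j)"
    if "j < N" "\<not> q dvd j" for j
    using pm that unfolding parent_map_def nonroots ends_wheel by blast+
  have "\<exists>s. f (pos j) = target s j" if j: "j < N" "\<not> q dvd j" for j
  proof (rule edge_at_pos[OF j])
    show "{pos j, f (pos j)} \<in> edges (wheel N)" using pj[OF j] by simp
    show "f (pos j) \<noteq> pos j" using pj(3)[OF j] by auto
  qed
  then obtain s where s: "\<And>j. j < N \<Longrightarrow> \<not> q dvd j \<Longrightarrow> f (pos j) = target (s j) j" by metis
  define w where "w j = (if j < N \<and> \<not> q dvd j then s j else Hub)" for j
  \<comment> \<open>\<open>Next\<close> followed by \<open>Prev\<close> would make two neighbours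
    each other's parent, so each rank would be below the other.\<close>
  have "w (Suc j) \<noteq> Prev" if "w j = Next" for j
  proof
    assume "w (Suc j) = Prev"
    with that have j: "j < N" "\<not> q dvd j" "s j = Next" "Suc j < N" "\<not> q dvd Suc j" "s (Suc j) = Prev"
      by (auto simp: w_def split: if_splits)
    then show False using pj(3)[OF j(1,2)] pj(3)[OF j(4,5)] s[OF j(1,2)] s[OF j(4,5)] by simp
  qed
  then have "w \<in> words q N" by (auto simp: words_def w_def)
  moreover have "p ` (verts (wheel N) - roots) = word_forest w"
    unfolding word_forest_def nonroots image_image
    by (intro image_cong) (auto simp: word_edge_def pj(2) s w_def)
  ultimately show ?thesis by blast
qed

lemma card_rooted_spanning_forests:
  "card (rooted_spanning_forests (wheel N) roots) = card (words q N)"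
proof -
  have "rooted_spanning_forests (wheel N) roots = word_forest ` words q N"
  proof (intro equalityI subsetI)
    fix T assume "T \<in> rooted_spanning_forests (wheel N) roots"
    then obtain p f h where "parent_map (wheel N) roots p f h" "T = p ` (verts (wheel N) - roots)"
      by (rule forest_parent_map[OF wf_wheel])
    then show "T \<in> word_forest ` words q N" using word_of_parent_map by blast
  next
    fix T assume "T \<in> word_forest ` words q N"
    then show "T \<in> rooted_spanning_forests (wheel N) roots"
      using parent_map_forest[OF word_parent_map roots_subset] by (auto simp: word_forest_eq)
  qed
  then show ?thesis using card_image[OF inj_word_forest] by simp
qed

end

section \<open>Equal cyclic intervals as an arithmetic progression, and the final count\<close>

lemma equal_intervals_arith_progression:
  assumes q: "0 < q" and r: "0 < r" and N: "N = r * q"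
    and R: "R \<subseteq> rim_vertices N" "card R = r"
    and d: "\<forall>i \<in> {1..r}. cyclic_interval N R i = q"
  obtains b where "b < q" "R = (\<lambda>k. Rim (b + k * q + 1)) ` {..<r}"
proof -
  define A where "A = {j. Rim j \<in> R}"
  define a where "a = sorted_list_of_set A"
  have RA: "R = Rim ` A" using R(1) by (auto simp: A_def rim_vertices_def)
  have A: "A \<subseteq> {1..N}" using R(1) by (auto simp: A_def rim_vertices_def)
  then have fin: "finite A" using finite_subset by blast
  have "card A = r" using R(2) unfolding RA by (simp add: card_image inj_on_def)
  then have a: "length a = r" "set a = A" using fin by (auto simp: a_def)
  have step: "a ! i = a ! 0 + i * q" if "i < r" for i
    using that
  proof (induction i)
    case (Suc i)
    have "cyclic_interval N R (Suc i) = q" using d Suc.prems by simp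
    then have "a ! Suc i - a ! i = q"
      using Suc.prems a by (simp add: cyclic_interval_def A_def[symmetric] a_def[symmetric] Let_def)
    \<comment> \<open>Since \<open>q\<close> is positive, the truncated difference is exact.\<close>
    then show ?case using Suc q by auto
  qed simp
  have "a ! 0 \<in> A" "a ! (r - 1) \<in> A" using a r by (auto intro: nth_mem)
  then have a0: "1 \<le> a ! 0" and "a ! (r - 1) \<le> N" using A by auto
  \<comment> \<open>The largest label is at most \<open>N = r * q\<close>, which bounds the smallest
    one by \<open>q\<close>. Labels start at 1, so the offset is the smallest label minus 1.\<close>
  then have "a ! 0 + (r - 1) * q \<le> (r - 1) * q + q" using step[of "r - 1"] r N
    by (cases r) auto
  then have b: "a ! 0 - 1 < q" using a0 by simp
  have "A = (\<lambda>k. a ! k) ` {..<r}" using a by (metis atLeast_upt list.set_map map_nth)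
  moreover have "a ! k = a ! 0 - 1 + k * q + 1" if "k < r" for k
    using step[OF that] a0 by simp
  ultimately have "A = (\<lambda>k. a ! 0 - 1 + k * q + 1) ` {..<r}"
    by (metis (no_types, lifting) image_cong lessThan_iff)
  then have "R = (\<lambda>k. Rim (a ! 0 - 1 + k * q + 1)) ` {..<r}" unfolding RA by (simp add: image_image)
  with b show thesis by (rule that)
qed

theorem corollary3p6:
  fixes N r q :: nat and R :: "wheel_vertex set"
  assumes "3 \<le> N" and "0 < r" and "0 < q" and "N = r * q"
    and "R \<subseteq> rim_vertices N" and "card R = r"
    and "\<forall>i \<in> {1..r}. cyclic_interval N R i = q"
  shows "num_rooted_forests (wheel N) ({Center} \<union> R) = tau (contract (wheel N) ({Center} \<union> R))
    \<and> tau (contract (wheel N) ({Center} \<union> R)) = fib (2 * q) ^ r"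
proof -
  obtain b where b: "b < q" "R = (\<lambda>k. Rim (b + k * q + 1)) ` {..<r}"
    using equal_intervals_arith_progression[OF assms(3,2,4-7)] by blast
  interpret spaced_wheel N q b using assms by unfold_locales auto
  have mult: "{j. j < N \<and> q dvd j} = (\<lambda>k. k * q) ` {..<r}"
    using assms(3,4) by (auto simp: mult.commute)
  \<comment> \<open>No root wraps around the rim, so the remainder in \<open>pos\<close>
    disappears.\<close>
  have "b + k * q < N" if "k < r" for k
  proof -
    have "b + k * q < Suc k * q" using b(1) by simp
    also have "\<dots> \<le> N" using that unfolding assms(4) by (intro mult_le_mono1) simp
    finally show ?thesis .
  qed
  then have "R = pos ` {j. j < N \<and> q dvd j}"
    unfolding b(2) mult image_image pos_def by (intro image_cong) auto
  then have roots: "{Center} \<union> R = roots" by (simp add: roots_def)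
  have "tau (contract (wheel N) roots) = num_rooted_forests (wheel N) roots"
    using spanning_trees_contract[OF wf_wheel roots_subset]
    by (simp add: tau_def num_rooted_forests_def roots_def)
  moreover have "num_rooted_forests (wheel N) roots = fib (2 * q) ^ r"
    using card_words[OF assms(3), of r] card_rooted_spanning_forests assms(4)
    by (simp add: num_rooted_forests_def)
  ultimately show ?thesis unfolding roots by simp
qed

end
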